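(* Let $(B_t)_{t\ge 0}$ be a one-dimensional Brownian motion, and let $g:\mathbb{R}\to(0,\infty)$ be a Borel measurable function which grows at most exponentially. If the process $g(B_t)/\mathbb{E}g(B_t)$, $t\ge0$, is a martingale, then there is a twice differentiable function $\tilde g$ such that $g=\tilde g$ Lebesgue almost everywhere and $\dfrac{A\tilde g}{\tilde g}$ is constant, where $A=\frac12\frac{d^2}{dx^2}$ is the (weakly extended) generator of Brownian motion. Moreover, every such (positive) $g$ is of the form $g(x)=ae^{cx}+be^{-cx}$ for Lebesgue almost every $x\in\mathbb{R}$, for suitable constants $a,b,c\ge0$.
   Context: Brownian motion starts at $B_0=0$ and is standard (variance $t$ at time $t$). Growing at most exponentially means $|g(x)|\le Ce^{\kappa|x|}$ for all $x$, for some constants $C>0$, $\kappa\geq 0$. Martingales are with respect to the natural filtration $\mathcal{F}_t=\sigma(B_s:s\le t)$. On twice differentiable functions $A\tilde g=\frac12\tilde g''$. *)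

theory Defs
  imports "HOL-Probability.Probability"
begin

text \<open>
  Processes are indexed by \<open>t :: real\<close>; only the values at \<open>t \<ge> 0\<close> matter, and every clause below is
  restricted to those.  The starting point and continuity of paths are required almost surely.
\<close>

locale brownian_motion = prob_space M for M :: "'w measure" +
  fixes B :: "real \<Rightarrow> 'w \<Rightarrow> real"
  assumes measurable_B: "\<And>t. 0 \<le> t \<Longrightarrow> random_variable borel (B t)"
    and start_B: "AE \<omega> in M. B 0 \<omega> = 0"
    and indep_increments_B:
      "\<And>(n :: nat) (t :: nat \<Rightarrow> real). 0 \<le> t 0 \<Longrightarrow> (\<And>i. i < n \<Longrightarrow> t i < t (Suc i)) \<Longrightarrow>
         indep_vars (\<lambda>_. borel) (\<lambda>i \<omega>. B (t (Suc i)) \<omega> - B (t i) \<omega>) {..<n}"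
    and normal_increments_B:
      "\<And>s t. 0 \<le> s \<Longrightarrow> s < t \<Longrightarrow>
         distributed M lborel (\<lambda>\<omega>. B t \<omega> - B s \<omega>) (normal_density 0 (sqrt (t - s)))"
    and continuous_B: "AE \<omega> in M. continuous_on {0..} (\<lambda>t. B t \<omega>)"

text \<open>Uncompleted: no null sets of \<open>M\<close> are added.\<close>

definition natural_filtration ::
  "'w measure \<Rightarrow> (real \<Rightarrow> 'w \<Rightarrow> real) \<Rightarrow> real \<Rightarrow> 'w measure" where
  "natural_filtration M X t =
     sigma (space M) {X s -` S \<inter> space M | s S. 0 \<le> s \<and> s \<le> t \<and> S \<in> sets borel}"

definition martingale ::
  "'w measure \<Rightarrow> (real \<Rightarrow> 'w measure) \<Rightarrow> (real \<Rightarrow> 'w \<Rightarrow> real) \<Rightarrow> bool" where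
  "martingale M F X \<longleftrightarrow>
     (\<forall>t\<ge>0. subalgebra M (F t)) \<and>
     (\<forall>s t. 0 \<le> s \<longrightarrow> s \<le> t \<longrightarrow> subalgebra (F t) (F s)) \<and>
     (\<forall>t\<ge>0. X t \<in> borel_measurable (F t) \<and> integrable M (X t)) \<and>
     (\<forall>s t. 0 \<le> s \<longrightarrow> s \<le> t \<longrightarrow> (AE \<omega> in M. real_cond_exp M (F s) (X t) \<omega> = X s \<omega>))"

text \<open>The two filtration clauses of \<open>martingale\<close> hold automatically for natural filtrations.\<close>

lemma space_natural_filtration [simp]: "space (natural_filtration M X t) = space M"
  unfolding natural_filtration_def by (rule space_measure_of) auto

lemma sets_natural_filtration:
  "sets (natural_filtration M X t) =
     sigma_sets (space M) {X s -` S \<inter> space M | s S. 0 \<le> s \<and> s \<le> t \<and> S \<in> sets borel}"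
  unfolding natural_filtration_def by (rule sets_measure_of) auto

lemma subalgebra_natural_filtration:
  assumes "\<And>s. 0 \<le> s \<Longrightarrow> X s \<in> borel_measurable M"
  shows "subalgebra M (natural_filtration M X t)"
  unfolding subalgebra_def sets_natural_filtration
  using assms by (auto intro!: sets.sigma_sets_subset dest: measurable_sets)

lemma natural_filtration_mono:
  "s \<le> t \<Longrightarrow> subalgebra (natural_filtration M X t) (natural_filtration M X s)"
  unfolding subalgebra_def sets_natural_filtration
  by (auto intro!: sigma_sets_mono'; fastforce)

definition grows_at_most_exponentially :: "(real \<Rightarrow> real) \<Rightarrow> bool" where
  "grows_at_most_exponentially g \<longleftrightarrow> (\<exists>C>0. \<exists>\<kappa>\<ge>0. \<forall>x. \<bar>g x\<bar> \<le> C * exp (\<kappa> * \<bar>x\<bar>))"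

definition twice_differentiable :: "(real \<Rightarrow> real) \<Rightarrow> bool" where
  "twice_differentiable f \<longleftrightarrow>
     (\<forall>x. f field_differentiable at x) \<and> (\<forall>x. deriv f field_differentiable at x)"

text \<open>The generator of Brownian motion; meaningful on twice differentiable functions only.\<close>

definition bm_generator :: "(real \<Rightarrow> real) \<Rightarrow> real \<Rightarrow> real" where
  "bm_generator f x = deriv (deriv f) x / 2"

end

theory Submission
  imports Defs
begin

text \<open>
  By independence of increments, the martingale property between the times \<open>1\<close> and \<open>1 + r\<close> says
  that the Gaussian average of \<open>g\<close> of variance \<open>r\<close> equals \<open>g\<close> up to a positive factor, almost
  everywhere.  Hence \<open>g\<close> has a smooth version \<open>h\<close>, and by continuity the same relation between \<open>h\<close>
  and all the Gaussian averages holds at every point.  Differentiating it in the variance, the heat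
  equation turns it into \<open>h'' = k h\<close>.  Positivity of \<open>h\<close> excludes the oscillating solutions
  \<open>k < 0\<close>, the non-constant affine ones for \<open>k = 0\<close>, and negative coefficients for \<open>k > 0\<close>.
\<close>

section \<open>Gaussian moments\<close>

text \<open>Differentiation under the integral sign: the mean value inequality bounds all difference
  quotients by \<open>w\<close>, so dominated convergence applies along every sequence tending to
  \<open>a\<close>.\<close>

lemma has_field_derivative_integral_dominated:
  fixes f f' :: "real \<Rightarrow> 'a \<Rightarrow> real"
  assumes "0 < \<epsilon>"
    and int: "\<And>x. x \<in> ball a \<epsilon> \<Longrightarrow> integrable M (f x)"
    and der: "\<And>x y. x \<in> ball a \<epsilon> \<Longrightarrow> ((\<lambda>x. f x y) has_real_derivative f' x y) (at x)"
    and meas: "f' a \<in> borel_measurable M"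
    and bound: "\<And>x y. x \<in> ball a \<epsilon> \<Longrightarrow> \<bar>f' x y\<bar> \<le> w y"
    and w: "integrable M w"
  shows "((\<lambda>x. \<integral>y. f x y \<partial>M) has_real_derivative (\<integral>y. f' a y \<partial>M)) (at a)"
proof -
  have a: "a \<in> ball a \<epsilon>" using \<open>0 < \<epsilon>\<close> by simp
  have "((\<lambda>x. ((\<integral>y. f x y \<partial>M) - (\<integral>y. f a y \<partial>M)) / (x - a)) \<longlongrightarrow> (\<integral>y. f' a y \<partial>M))
      (at a within ball a \<epsilon>)"
    unfolding tendsto_at_iff_sequentially
  proof (intro allI impI)
    fix X assume X: "\<forall>i. X i \<in> ball a \<epsilon> - {a}" and lim: "X \<longlonglongrightarrow> a"
    let ?q = "\<lambda>n y. (f (X n) y - f a y) / (X n - a)"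
    have q: "(\<integral>y. ?q n y \<partial>M) = ((\<integral>y. f (X n) y \<partial>M) - (\<integral>y. f a y \<partial>M)) / (X n - a)" for n
      using X int[of "X n"] int[OF a] by simp
    have "(\<lambda>n. \<integral>y. ?q n y \<partial>M) \<longlonglongrightarrow> (\<integral>y. f' a y \<partial>M)"
    proof (rule integral_dominated_convergence[OF meas _ w])
      show "?q n \<in> borel_measurable M" for n
      proof -
        have [measurable]: "f (X n) \<in> borel_measurable M" "f a \<in> borel_measurable M"
          using X int[of "X n"] int[OF a] by auto
        show ?thesis by measurable
      qed
      show "AE y in M. (\<lambda>n. ?q n y) \<longlonglongrightarrow> f' a y"
      proof (rule AE_I2)
        fix y
        have "((\<lambda>x. (f x y - f a y) / (x - a)) \<longlongrightarrow> f' a y) (at a)"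
          using der[OF a] by (simp add: has_field_derivative_iff)
        then show "(\<lambda>n. ?q n y) \<longlonglongrightarrow> f' a y"
          using X lim unfolding tendsto_at_iff_sequentially comp_def by simp
      qed
      show "AE y in M. norm (?q n y) \<le> w y" for n
      proof (rule AE_I2)
        fix y
        have "norm (f (X n) y - f a y) \<le> w y * norm (X n - a)"
        proof (rule field_differentiable_bound[OF convex_ball[of a \<epsilon>]])
          show "((\<lambda>x. f x y) has_real_derivative f' z y) (at z within ball a \<epsilon>)" if "z \<in> ball a \<epsilon>" for z
            using der[OF that] by (rule has_field_derivative_at_within)
          show "norm (f' z y) \<le> w y" if "z \<in> ball a \<epsilon>" for z
            using bound[OF that] by simp
        qed (use X a in auto)
        moreover have "0 < norm (X n - a)" using X by simp
        ultimately show "norm (?q n y) \<le> w y"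
          by (simp add: pos_divide_le_eq)
      qed
    qed
    then show "((\<lambda>x. ((\<integral>y. f x y \<partial>M) - (\<integral>y. f a y \<partial>M)) / (x - a)) \<circ> X) \<longlonglongrightarrow> (\<integral>y. f' a y \<partial>M)"
      unfolding q comp_def .
  qed
  then show ?thesis
    using a by (simp add: has_field_derivative_iff at_within_open[of a "ball a \<epsilon>"])
qed

text \<open>Completing the square makes \<open>exp (c * y - b * y\<^sup>2)\<close> a multiple of the
  normal density with mean \<open>c / (2 * b)\<close> and variance \<open>1 / (2 * b)\<close>. The
  cases \<open>c = m\<close> and \<open>c = - m\<close> together dominate the version with
  \<open>\<bar>y\<bar>\<close>.\<close>

lemma integrable_exp_abs_gaussian:
  fixes m b :: real
  assumes "0 < b"
  shows "integrable lborel (\<lambda>y. exp (m * \<bar>y\<bar> - b * y\<^sup>2))"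
proof -
  have int: "integrable lborel (\<lambda>y. exp (c * y - b * y\<^sup>2))" for c
  proof -
    let ?s = "sqrt (1 / (2 * b))"
    have "(\<lambda>y. exp (c * y - b * y\<^sup>2)) =
        (\<lambda>y. (sqrt (pi / b) * exp (c\<^sup>2 / (4 * b))) * normal_density (c / (2 * b)) ?s y)"
    proof
      fix y
      have "c * y - b * y\<^sup>2 = c\<^sup>2 / (4 * b) - (y - c / (2 * b))\<^sup>2 / (2 * ?s\<^sup>2)"
        using assms by (simp add: field_simps power2_eq_square)
      then have "exp (c * y - b * y\<^sup>2) =
          exp (c\<^sup>2 / (4 * b)) * exp (- (y - c / (2 * b))\<^sup>2 / (2 * ?s\<^sup>2))"
        by (simp flip: exp_add)
      moreover have "sqrt (pi / b) * (1 / sqrt (2 * pi * ?s\<^sup>2)) = 1"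
        using assms by simp
      ultimately show "exp (c * y - b * y\<^sup>2) =
          (sqrt (pi / b) * exp (c\<^sup>2 / (4 * b))) * normal_density (c / (2 * b)) ?s y"
        by (simp only: normal_density_def mult.assoc mult.left_commute[of "exp _" "1 / _"])
          (simp only: mult.assoc[symmetric] mult_1)
    qed
    then show ?thesis using assms by (auto intro!: integrable_mult_right integrable_normal_density)
  qed
  show ?thesis
  proof (rule Bochner_Integration.integrable_bound)
    show "integrable lborel (\<lambda>y. exp (m * y - b * y\<^sup>2) + exp ((- m) * y - b * y\<^sup>2))"
      using int[of m] int[of "- m"] by (rule Bochner_Integration.integrable_add)
    show "AE y in lborel. norm (exp (m * \<bar>y\<bar> - b * y\<^sup>2))
        \<le> norm (exp (m * y - b * y\<^sup>2) + exp ((- m) * y - b * y\<^sup>2))"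
    proof (rule AE_I2)
      show "norm (exp (m * \<bar>y\<bar> - b * y\<^sup>2)) \<le> norm (exp (m * y - b * y\<^sup>2) + exp ((- m) * y - b * y\<^sup>2))"
        for y by (cases "0 \<le> y") (simp_all add: abs_of_pos add_pos_pos)
    qed
  qed measurable
qed

text \<open>The Gaussian is left unnormalised and is parametrised by \<open>b\<close>, which
  corresponds to variance \<open>1 / (2 * b)\<close>. A derivative in \<open>b\<close> then only
  inserts the factor \<open>- (y - x)\<^sup>2\<close>.\<close>

definition gauss_moment :: "(real \<Rightarrow> real) \<Rightarrow> nat \<Rightarrow> real \<Rightarrow> real \<Rightarrow> real" where
  "gauss_moment g k b x = (\<integral>y. g y * (y - x) ^ k * exp (- b * (y - x)\<^sup>2) \<partial>lborel)"

text \<open>The bound is uniform in \<open>\<bar>x\<bar> \<le> R\<close> and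
  \<open>\<delta> \<le> b\<close>, as domination requires for differentiating both in the center and
  in the exponent. The power is absorbed into an exponential, and \<open>(y - x)\<^sup>2\<close> is
  at least \<open>y\<^sup>2 - 2 * R * \<bar>y\<bar>\<close>.\<close>

lemma gauss_moment_integrand_bound:
  fixes g :: "real \<Rightarrow> real" and x y R \<delta> b C \<kappa> :: real and k :: nat
  assumes g: "\<bar>g y\<bar> \<le> C * exp (\<kappa> * \<bar>y\<bar>)" and "\<bar>x\<bar> \<le> R" "0 < \<delta>" "\<delta> \<le> b"
  shows "\<bar>g y * (y - x) ^ k * exp (- b * (y - x)\<^sup>2)\<bar>
    \<le> C * exp (k * R) * exp ((\<kappa> + k + 2 * \<delta> * R) * \<bar>y\<bar> - \<delta> * y\<^sup>2)"
proof -
  have "\<bar>y - x\<bar> \<le> exp \<bar>y - x\<bar>"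
    using exp_ge_add_one_self[of "\<bar>y - x\<bar>"] by linarith
  also have "\<dots> \<le> exp (R + \<bar>y\<bar>)" using assms by simp
  finally have "\<bar>y - x\<bar> ^ k \<le> exp (R + \<bar>y\<bar>) ^ k" by (intro power_mono) auto
  then have p: "\<bar>y - x\<bar> ^ k \<le> exp (k * (R + \<bar>y\<bar>))" by (simp add: exp_of_nat_mult)
  have "\<bar>x * y\<bar> \<le> R * \<bar>y\<bar>" unfolding abs_mult using assms by (intro mult_right_mono) auto
  then have "x * y \<le> R * \<bar>y\<bar>" by linarith
  then have "y\<^sup>2 - 2 * (R * \<bar>y\<bar>) \<le> (y - x)\<^sup>2" 
    using zero_le_power2[of x] by (simp only: power2_diff mult.assoc mult.commute[of y x])
  then have "\<delta> * (y\<^sup>2 - 2 * (R * \<bar>y\<bar>)) \<le> \<delta> * (y - x)\<^sup>2" using assms by simp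
  also have "\<dots> \<le> b * (y - x)\<^sup>2" using assms by (intro mult_right_mono) auto
  finally have e: "exp (- b * (y - x)\<^sup>2) \<le> exp (2 * \<delta> * R * \<bar>y\<bar> - \<delta> * y\<^sup>2)"
    by (simp add: algebra_simps)
  have C: "0 \<le> C * exp (\<kappa> * \<bar>y\<bar>)" using g by linarith
  have "\<bar>g y * (y - x) ^ k * exp (- b * (y - x)\<^sup>2)\<bar> = \<bar>g y\<bar> * \<bar>y - x\<bar> ^ k * exp (- b * (y - x)\<^sup>2)"
    by (simp add: abs_mult power_abs)
  also have "\<dots> \<le> C * exp (\<kappa> * \<bar>y\<bar>) * exp (k * (R + \<bar>y\<bar>)) * exp (2 * \<delta> * R * \<bar>y\<bar> - \<delta> * y\<^sup>2)"
    using C by (intro mult_mono g p e) auto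
  also have "\<dots> = C * exp (k * R) * exp ((\<kappa> + k + 2 * \<delta> * R) * \<bar>y\<bar> - \<delta> * y\<^sup>2)"
    by (simp add: exp_add[symmetric] algebra_simps)
  finally show ?thesis .
qed

locale exponential_growth =
  fixes g :: "real \<Rightarrow> real" and C \<kappa> :: real
  assumes measurable_g[measurable]: "g \<in> borel_measurable borel"
    and growth: "\<bar>g y\<bar> \<le> C * exp (\<kappa> * \<bar>y\<bar>)"
begin

lemma integrable_gauss_moment:
  assumes "0 < b"
  shows "integrable lborel (\<lambda>y. g y * (y - x) ^ k * exp (- b * (y - x)\<^sup>2))"
proof (rule Bochner_Integration.integrable_bound)
  show "integrable lborel (\<lambda>y. C * exp (k * \<bar>x\<bar>) * exp ((\<kappa> + k + 2 * b * \<bar>x\<bar>) * \<bar>y\<bar> - b * y\<^sup>2))"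
    using assms integrable_exp_abs_gaussian by simp
  show "AE y in lborel. norm (g y * (y - x) ^ k * exp (- b * (y - x)\<^sup>2))
      \<le> norm (C * exp (k * \<bar>x\<bar>) * exp ((\<kappa> + k + 2 * b * \<bar>x\<bar>) * \<bar>y\<bar> - b * y\<^sup>2))"
    unfolding real_norm_def using assms
    by (intro AE_I2 order_trans[OF gauss_moment_integrand_bound[where g = g, OF growth] abs_ge_self]) auto
qed measurable

lemma has_derivative_gauss_moment_exponent:
  assumes "0 < b"
  shows "((\<lambda>b. gauss_moment g k b x) has_real_derivative - gauss_moment g (k + 2) b x) (at b)"
proof -
  \<comment> \<open>On the ball of radius \<open>b / 2\<close> around \<open>b\<close> the exponents
    stay above \<open>b / 2\<close>, so this is the uniform bound with
    \<open>\<delta> = b / 2\<close> and power \<open>k + 2\<close>.\<close>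
  let ?w = "\<lambda>y. C * exp (real (k + 2) * \<bar>x\<bar>) *
    exp ((\<kappa> + real (k + 2) + 2 * (b / 2) * \<bar>x\<bar>) * \<bar>y\<bar> - b / 2 * y\<^sup>2)"
  have "((\<lambda>b. gauss_moment g k b x) has_real_derivative
      (\<integral>y. - (g y * (y - x) ^ (k + 2) * exp (- b * (y - x)\<^sup>2)) \<partial>lborel)) (at b)"
    unfolding gauss_moment_def
  proof (rule has_field_derivative_integral_dominated
      [where \<epsilon> = "b / 2" and w = ?w
        and f' = "\<lambda>b y. - (g y * (y - x) ^ (k + 2) * exp (- b * (y - x)\<^sup>2))"])
    fix c y assume "c \<in> ball b (b / 2)"
    then have c: "b / 2 \<le> c" "0 < c" using assms unfolding dist_real_def mem_ball by linarith+
    show "integrable lborel (\<lambda>y. g y * (y - x) ^ k * exp (- c * (y - x)\<^sup>2))"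
      using c by (rule_tac integrable_gauss_moment)
    show "((\<lambda>b. g y * (y - x) ^ k * exp (- b * (y - x)\<^sup>2)) has_real_derivative
        - (g y * (y - x) ^ (k + 2) * exp (- c * (y - x)\<^sup>2))) (at c)"
      by (auto intro!: derivative_eq_intros simp: power_add power2_eq_square)
    show "\<bar>- (g y * (y - x) ^ (k + 2) * exp (- c * (y - x)\<^sup>2))\<bar> \<le> ?w y"
      unfolding abs_minus_cancel using c assms
      by (intro gauss_moment_integrand_bound growth) auto
  next
    show "integrable lborel ?w" using assms integrable_exp_abs_gaussian[of "b / 2"] by simp
  qed (use assms in \<open>auto\<close>)
  then show ?thesis by (simp add: gauss_moment_def)
qed

text \<open>The Gaussian factor raises the power by one and the monomial lowers it by one. For
  \<open>k = 0\<close> the truncated \<open>k - 1\<close> is harmless, since its coefficient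
  vanishes. Applied twice from \<open>k = 0\<close>, the rule produces the moment of order 2, which
  is also minus the derivative in \<open>b\<close>: this is the heat equation in the present
  parametrisation.\<close>

lemma has_derivative_gauss_moment_center:
  assumes b: "0 < b"
  shows "(gauss_moment g k b has_real_derivative
    2 * b * gauss_moment g (k + 1) b x - k * gauss_moment g (k - 1) b x) (at x)"
proof -
  define R where "R = \<bar>x\<bar> + 1"
  define F where "F i z = (\<lambda>y. g y * (y - z) ^ i * exp (- b * (y - z)\<^sup>2))" for i z
  define w where "w i = (\<lambda>y. C * exp (real i * R) *
    exp ((\<kappa> + real i + 2 * b * R) * \<bar>y\<bar> - b * y\<^sup>2))" for i
  have w: "integrable lborel (w i)" for i
    unfolding w_def using b by (intro integrable_mult_right integrable_exp_abs_gaussian)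
  have F: "integrable lborel (F i z)" for i z
    unfolding F_def using b by (rule integrable_gauss_moment)
  have [measurable]: "F i z \<in> borel_measurable lborel" for i z
    using F by auto
  have bound: "\<bar>F i z y\<bar> \<le> w i y" if "z \<in> ball x 1" for i z y
  proof -
    have "\<bar>z\<bar> \<le> R" using that unfolding R_def dist_real_def mem_ball by linarith
    then show ?thesis
      unfolding F_def w_def using b by (intro gauss_moment_integrand_bound growth) auto
  qed
  have "((\<lambda>z. \<integral>y. F k z y \<partial>lborel) has_real_derivative
      (\<integral>y. 2 * b * F (k + 1) x y - k * F (k - 1) x y \<partial>lborel)) (at x)"
  proof (rule has_field_derivative_integral_dominated
      [where \<epsilon> = 1 and w = "\<lambda>y. 2 * b * w (k + 1) y + k * w (k - 1) y"
        and f' = "\<lambda>z y. 2 * b * F (k + 1) z y - k * F (k - 1) z y"])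
    fix z y assume z: "z \<in> ball x 1"
    show "((\<lambda>z. F k z y) has_real_derivative 2 * b * F (k + 1) z y - k * F (k - 1) z y) (at z)"
      unfolding F_def
      by (auto intro!: derivative_eq_intros) (simp add: algebra_simps)
    have "\<bar>2 * b * F (k + 1) z y - k * F (k - 1) z y\<bar>
        \<le> 2 * b * \<bar>F (k + 1) z y\<bar> + k * \<bar>F (k - 1) z y\<bar>"
      using b by (intro order_trans[OF abs_triangle_ineq4]) (simp add: abs_mult)
    also have "\<dots> \<le> 2 * b * w (k + 1) y + k * w (k - 1) y"
      using b by (intro add_mono mult_left_mono bound z) auto
    finally show "\<bar>2 * b * F (k + 1) z y - k * F (k - 1) z y\<bar> \<le> 2 * b * w (k + 1) y + k * w (k - 1) y" .
  qed (use F w in auto)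
  moreover have "gauss_moment g i b = (\<lambda>z. \<integral>y. F i z y \<partial>lborel)" for i
    by (simp add: gauss_moment_def F_def fun_eq_iff)
  ultimately show ?thesis using F by simp
qed

end

text \<open>The translation \<open>y\<close> to \<open>x + y\<close> passes from the probabilistic
  average of variance \<open>r\<close> to the unnormalised moment.\<close>

lemma gauss_moment_0_eq_normal:
  assumes "0 < r"
  shows "(\<integral>y. normal_density 0 (sqrt r) y * g (x + y) \<partial>lborel)
    = gauss_moment g 0 (1 / (2 * r)) x / sqrt (2 * pi * r)"
proof -
  have "gauss_moment g 0 (1 / (2 * r)) x =
      (\<integral>y. g (x + y) * exp (- (1 / (2 * r)) * y\<^sup>2) \<partial>lborel)"
    unfolding gauss_moment_def
    by (subst lborel_integral_real_affine[where c = 1 and t = x]) simp_all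
  then have "gauss_moment g 0 (1 / (2 * r)) x / sqrt (2 * pi * r) =
      (\<integral>y. g (x + y) * exp (- (1 / (2 * r)) * y\<^sup>2) / sqrt (2 * pi * r) \<partial>lborel)"
    by simp
  also have "\<dots> = (\<integral>y. normal_density 0 (sqrt r) y * g (x + y) \<partial>lborel)"
    using assms by (intro Bochner_Integration.integral_cong) (auto simp: normal_density_def)
  finally show ?thesis by simp
qed

text \<open>A nonnegative integrand with zero integral vanishes almost everywhere, which strict
  positivity forbids because Lebesgue measure is not zero.\<close>

lemma (in exponential_growth) gauss_moment_0_pos:
  assumes "\<And>y. 0 < g y" and b: "0 < b"
  shows "0 < gauss_moment g 0 b x"
proof -
  let ?f = "\<lambda>y. g y * (y - x) ^ 0 * exp (- b * (y - x)\<^sup>2)"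
  have f: "0 < ?f y" for y using assms(1)[of y] by simp
  have int: "integrable lborel ?f" using b by (rule integrable_gauss_moment)
  have "integral\<^sup>L lborel ?f \<noteq> 0"
  proof
    assume "integral\<^sup>L lborel ?f = 0"
    moreover have "(integral\<^sup>L lborel ?f = 0) = (AE y in lborel. ?f y = 0)"
      using f by (intro integral_nonneg_eq_0_iff_AE[OF int] AE_I2 less_imp_le)
    ultimately have "AE y in lborel. ?f y = 0" by blast
    then have "AE y in (lborel :: real measure). False"
      by eventually_elim (use f in \<open>metis less_irrefl\<close>)
    then show False
      by (simp add: AE_iff_measurable[of UNIV] emeasure_lborel_UNIV)
  qed
  moreover have "0 \<le> integral\<^sup>L lborel ?f"
    using f by (intro Bochner_Integration.integral_nonneg less_imp_le)
  ultimately show ?thesis unfolding gauss_moment_def by linarith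
qed

text \<open>The set of disagreement is open and null, hence empty.\<close>

lemma continuous_AE_eq_imp_eq:
  fixes u v :: "real \<Rightarrow> real"
  assumes "continuous_on UNIV u" "continuous_on UNIV v" "AE x in lborel. u x = v x"
  shows "u x = v x"
proof (rule ccontr)
  assume "u x \<noteq> v x"
  let ?S = "{x. u x \<noteq> v x}"
  have "open ?S" by (rule open_Collect_neq[OF assms(1,2)])
  then have "?S \<in> sets lborel" by simp
  then have "?S \<in> null_sets lborel"
    using assms(3) AE_iff_null_sets[of ?S lborel] by simp
  then have "negligible ?S"
    by (simp add: negligible_iff_null_sets null_sets_completionI)
  then show False
    using open_not_negligible[OF \<open>open ?S\<close>] \<open>u x \<noteq> v x\<close> by blast
qed

section \<open>Positive solutions of \<open>h'' = k h\<close>\<close>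

lemma positive_solution_nonneg_eigenvalue:
  fixes h h' :: "real \<Rightarrow> real"
  assumes h: "\<And>x. (h has_real_derivative h' x) (at x)"
    and h': "\<And>x. (h' has_real_derivative k * h x) (at x)"
    and pos: "\<And>x. 0 < h x"
  shows "0 \<le> k"
proof (rule ccontr)
  assume "\<not> 0 \<le> k"
  define \<omega> where "\<omega> = sqrt (- k)"
  have \<omega>: "0 < \<omega>" "k = - \<omega>\<^sup>2" using \<open>\<not> 0 \<le> k\<close> by (auto simp: \<omega>_def)
  \<comment> \<open>the Wronskian of \<open>h\<close> and \<open>sin (\<omega> x)\<close>, evaluated below at two consecutive zeros of the sine\<close>
  define W where "W x = h' x * sin (\<omega> * x) - \<omega> * h x * cos (\<omega> * x)" for x
  have "(W has_real_derivative 0) (at x)" for x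
    unfolding W_def \<omega>(2)
    by (rule derivative_eq_intros h h'[unfolded \<omega>(2)] refl)+ (simp add: algebra_simps power2_eq_square)
  then have "W 0 = W (pi / \<omega>)" by (intro DERIV_isconst_all) auto
  \<comment> \<open>The sine vanishes at both points while the cosine is 1 and then -1, so
    \<open>W 0 = - \<omega> * h 0\<close> and
    \<open>W (pi / \<omega>) = \<omega> * h (pi / \<omega>)\<close>.\<close>
  then have "\<omega> * (h 0 + h (pi / \<omega>)) = 0" using \<omega>(1) by (simp add: W_def distrib_left)
  then have "h 0 + h (pi / \<omega>) = 0" using \<omega>(1) by simp
  then show False using pos[of 0] pos[of "pi / \<omega>"] by simp
qed

text \<open>For \<open>k = 0\<close> a positive affine function is constant. For
  \<open>k > 0\<close> two first integrals recover \<open>h\<close> from its data at 0, and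
  positivity of \<open>h\<close> on the whole line fixes the signs of the coefficients.\<close>

lemma positive_solution_form:
  fixes h h' :: "real \<Rightarrow> real"
  assumes h: "\<And>x. (h has_real_derivative h' x) (at x)"
    and h': "\<And>x. (h' has_real_derivative k * h x) (at x)"
    and pos: "\<And>x. 0 < h x"
  shows "\<exists>a b c. 0 \<le> a \<and> 0 \<le> b \<and> 0 \<le> c \<and> (\<forall>x. h x = a * exp (c * x) + b * exp (- c * x))"
proof (cases "k = 0")
  case True
  then have "h' x = h' 0" for x
    using h' by (intro DERIV_isconst_all) auto
  then have "((\<lambda>x. h x - h' 0 * x) has_real_derivative 0) (at x)" for x
    using h[of x] by (auto intro!: derivative_eq_intros)
  then have eq: "h x = h 0 + h' 0 * x" for x
    using DERIV_isconst_all[of "\<lambda>x. h x - h' 0 * x" x 0] by simp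
  have "h' 0 = 0"
  proof (rule ccontr)
    assume "h' 0 \<noteq> 0"
    then have "h (- h 0 / h' 0) = 0" by (subst eq) simp
    then show False using pos[of "- h 0 / h' 0"] by simp
  qed
  then have "\<forall>x. h x = h 0 * exp (0 * x) + 0 * exp (- 0 * x)" using eq by simp
  then show ?thesis using pos[of 0] by (metis order.refl less_imp_le)
next
  case False
  define c where "c = sqrt k"
  have c: "0 < c" "k = c\<^sup>2"
    using False positive_solution_nonneg_eigenvalue[OF assms] by (auto simp: c_def)
  \<comment> \<open>The operator \<open>h'' - c\<^sup>2 * h\<close> factors:
    \<open>h' + c * h\<close> solves \<open>u' = c * u\<close> and \<open>c * h - h'\<close> solves
    \<open>v' = - c * v\<close>. The exponential factors turn both into constants.\<close>
  define U V where "U x = (h' x + c * h x) * exp (- c * x)"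
    and "V x = (c * h x - h' x) * exp (c * x)" for x
  have "(U has_real_derivative 0) (at x)" for x
    unfolding U_def
    by (rule derivative_eq_intros h h'[unfolded c(2)] refl)+ (simp add: algebra_simps power2_eq_square)
  moreover have "(V has_real_derivative 0) (at x)" for x
    unfolding V_def
    by (rule derivative_eq_intros h h'[unfolded c(2)] refl)+ (simp add: algebra_simps power2_eq_square)
  ultimately have const: "U x = U 0" "V x = V 0" for x
    using DERIV_isconst_all[of U x 0] DERIV_isconst_all[of V x 0] by auto
  define a b where "a = U 0 / (2 * c)" and "b = V 0 / (2 * c)"
  have eq: "h x = a * exp (c * x) + b * exp (- c * x)" for x
  proof -
    have "2 * c * h x = U x * exp (c * x) + V x * exp (- c * x)"
      by (simp add: U_def V_def algebra_simps flip: exp_add)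
    also have "\<dots> = U 0 * exp (c * x) + V 0 * exp (- c * x)"
      by (simp only: const[of x])
    finally show ?thesis unfolding a_def b_def using c(1) by (simp add: field_simps)
  qed
  \<comment> \<open>Multiplying \<open>h x\<close> by \<open>exp (c * x)\<close> leaves
    \<open>a * s + b\<close> with \<open>s = exp (2 * c * x)\<close>, and every positive
    \<open>s\<close> arises in this way.\<close>
  have pos_lin: "0 < a * s + b" if "0 < s" for s
  proof -
    define x where "x = ln s / (2 * c)"
    have "2 * (c * x) = ln s" using c(1) by (simp add: x_def)
    then have "exp (c * x) * exp (c * x) = s" using that by (simp flip: exp_add)
    moreover have "exp (- c * x) * exp (c * x) = 1" by (simp flip: exp_add)
    moreover have "h x * exp (c * x) =
        a * (exp (c * x) * exp (c * x)) + b * (exp (- c * x) * exp (c * x))"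
      by (simp only: eq distrib_right mult.assoc)
    moreover have "0 < h x * exp (c * x)" using pos by simp
    ultimately show ?thesis by simp
  qed
  have "0 \<le> a"
  proof (rule ccontr)
    assume "\<not> 0 \<le> a"
    \<comment> \<open>At this \<open>s\<close> the expression \<open>a * s + b\<close> equals
      \<open>b - \<bar>b\<bar> - 1\<close>, which is negative.\<close>
    then have "0 < (\<bar>b\<bar> + 1) / - a" by (intro divide_pos_pos) auto
    from pos_lin[OF this] have "0 < a * ((\<bar>b\<bar> + 1) / - a) + b" .
    moreover have "a * ((\<bar>b\<bar> + 1) / - a) = - (\<bar>b\<bar> + 1)"
      using \<open>\<not> 0 \<le> a\<close> by (simp add: divide_simps)
    ultimately show False by linarith
  qed
  have "0 \<le> b"
  proof (rule tendsto_lowerbound)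
    show "((\<lambda>s. a * s + b) \<longlongrightarrow> b) (at_right 0)" by (auto intro!: tendsto_eq_intros)
    show "\<forall>\<^sub>F s in at_right 0. 0 \<le> a * s + b"
      using pos_lin by (intro eventually_at_rightI[of 0 1]) (auto intro: less_imp_le)
  qed simp
  show ?thesis using eq \<open>0 \<le> a\<close> \<open>0 \<le> b\<close> c(1) by (metis less_imp_le)
qed

section \<open>The martingale property of Brownian motion\<close>

context brownian_motion
begin

lemma distributed_B:
  assumes "0 < t"
  shows "distributed M lborel (B t) (normal_density 0 (sqrt t))"
proof -
  have [measurable]: "random_variable borel (B t)" "random_variable borel (B 0)"
    using measurable_B assms by auto
  have "distr M lborel (B t) = distr M lborel (\<lambda>\<omega>. B t \<omega> - B 0 \<omega>)"
    using start_B by (intro distr_cong_AE) auto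
  then show ?thesis
    using normal_increments_B[of 0 t] assms by (simp add: distributed_def)
qed

text \<open>The increments over \<open>0 < s < t\<close> are independent, and almost surely
  \<open>B s - B 0\<close> is \<open>B s\<close>.\<close>

lemma distributed_B_increment:
  assumes "0 < s" "s < t"
  shows "distributed M (lborel \<Otimes>\<^sub>M lborel) (\<lambda>\<omega>. (B s \<omega>, B t \<omega> - B s \<omega>))
    (\<lambda>(x, y). normal_density 0 (sqrt s) x * normal_density 0 (sqrt (t - s)) y)"
proof -
  have [measurable]: "random_variable borel (B t)" "random_variable borel (B 0)"
    "random_variable borel (B s)"
    using measurable_B assms by auto
  define \<tau> where "\<tau> i = (if i = 0 then 0 else if i = Suc 0 then s else t)" for i :: nat
  have "indep_vars (\<lambda>_. borel) (\<lambda>i \<omega>. B (\<tau> (Suc i)) \<omega> - B (\<tau> i) \<omega>) {..<2}"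
    using assms by (intro indep_increments_B) (auto simp: \<tau>_def less_2_cases_iff)
  moreover have "{..<2} = insert 0 {1::nat}" by auto
  \<comment> \<open>The sum over a singleton serves to turn the two-element independent family into
    an independent pair.\<close>
  ultimately have "indep_var borel (\<lambda>\<omega>. B (\<tau> (Suc 0)) \<omega> - B (\<tau> 0) \<omega>)
      borel (\<lambda>\<omega>. \<Sum>i\<in>{1}. B (\<tau> (Suc i)) \<omega> - B (\<tau> i) \<omega>)"
    by (intro indep_vars_sum) auto
  then have ind: "indep_var borel (\<lambda>\<omega>. B s \<omega> - B 0 \<omega>) borel (\<lambda>\<omega>. B t \<omega> - B s \<omega>)"
    by (simp add: \<tau>_def)
  have ind': "indep_var lborel (\<lambda>\<omega>. B s \<omega> - B 0 \<omega>) lborel (\<lambda>\<omega>. B t \<omega> - B s \<omega>)"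
    using indep_var_compose[OF ind, of "\<lambda>x. x" lborel "\<lambda>x. x" lborel] by (simp add: comp_def)
  have d0: "distributed M lborel (\<lambda>\<omega>. B s \<omega> - B 0 \<omega>) (normal_density 0 (sqrt s))"
    using normal_increments_B[of 0 s] assms by simp
  have "distributed M (lborel \<Otimes>\<^sub>M lborel) (\<lambda>\<omega>. (B s \<omega> - B 0 \<omega>, B t \<omega> - B s \<omega>))
    (\<lambda>(x, y). ennreal (normal_density 0 (sqrt s) x) * ennreal (normal_density 0 (sqrt (t - s)) y))"
    using d0 normal_increments_B[of s t] assms ind'
    by (intro distributed_joint_indep lborel.sigma_finite_measure_axioms) auto
  moreover have "distr M (lborel \<Otimes>\<^sub>M lborel) (\<lambda>\<omega>. (B s \<omega> - B 0 \<omega>, B t \<omega> - B s \<omega>))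
      = distr M (lborel \<Otimes>\<^sub>M lborel) (\<lambda>\<omega>. (B s \<omega>, B t \<omega> - B s \<omega>))"
    using start_B by (intro distr_cong_AE) auto
  ultimately show ?thesis
    by (simp add: distributed_def ennreal_mult'' split_beta')
qed

text \<open>Writing \<open>B t\<close> as \<open>B s\<close> plus an independent increment turns the
  expectation into a double integral of \<open>G (x + y)\<close>, and Fubini isolates the inner
  Gaussian average.\<close>

lemma
  fixes G :: "real \<Rightarrow> real"
  assumes [measurable]: "G \<in> borel_measurable borel" "S \<in> sets borel"
    and int: "integrable M (\<lambda>\<omega>. G (B t \<omega>))" and st: "0 < s" "s < t"
  shows integrable_transition:
      "integrable lborel (\<lambda>x. normal_density 0 (sqrt s) x *
         (\<integral>y. normal_density 0 (sqrt (t - s)) y * G (x + y) \<partial>lborel))" (is ?I)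
    and integral_transition:
      "(\<integral>\<omega>. indicator S (B s \<omega>) * G (B t \<omega>) \<partial>M) =
         (\<integral>x. indicator S x * (normal_density 0 (sqrt s) x *
           (\<integral>y. normal_density 0 (sqrt (t - s)) y * G (x + y) \<partial>lborel)) \<partial>lborel)" (is ?E)
proof -
  let ?p = "\<lambda>(x, y). normal_density 0 (sqrt s) x * normal_density 0 (sqrt (t - s)) y"
  let ?X = "\<lambda>\<omega>. (B s \<omega>, B t \<omega> - B s \<omega>)"
  have [measurable]: "random_variable borel (B t)" "random_variable borel (B s)"
    using measurable_B st by auto
  \<comment> \<open>\<open>S\<close> is kept variable: \<open>UNIV\<close> yields the integrability
    claim, the given set the integral formula.\<close>
  define H where "H S = (\<lambda>(x, y). indicator S x * G (x + y))" for S
  have d: "distributed M (lborel \<Otimes>\<^sub>M lborel) ?X (\<lambda>z. ennreal (?p z))"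
    using distributed_B_increment[OF st] by (simp add: split_beta')
  have key: "integrable (lborel \<Otimes>\<^sub>M lborel) (\<lambda>z. ?p z * H S z)"
      "(\<integral>z. ?p z * H S z \<partial>(lborel \<Otimes>\<^sub>M lborel)) = (\<integral>\<omega>. indicator S (B s \<omega>) * G (B t \<omega>) \<partial>M)"
    if [measurable]: "S \<in> sets borel" for S
  proof -
    have H: "H S \<in> borel_measurable (lborel \<Otimes>\<^sub>M lborel)"
      unfolding H_def by measurable
    have X: "H S (?X \<omega>) = indicator S (B s \<omega>) * G (B t \<omega>)" for \<omega> by (simp add: H_def)
    have "integrable M (\<lambda>\<omega>. indicator S (B s \<omega>) * G (B t \<omega>))"
      by (rule Bochner_Integration.integrable_bound[OF int]) (auto simp: indicator_def)
    then show "integrable (lborel \<Otimes>\<^sub>M lborel) (\<lambda>z. ?p z * H S z)"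
      using distributed_integrable[OF d H] X by (auto simp: split_beta')
    show "(\<integral>z. ?p z * H S z \<partial>(lborel \<Otimes>\<^sub>M lborel)) = (\<integral>\<omega>. indicator S (B s \<omega>) * G (B t \<omega>) \<partial>M)"
      using distributed_integral[OF d H] X by (auto simp: split_beta')
  qed
  have inner: "(\<integral>y. ?p (x, y) * H S (x, y) \<partial>lborel) = indicator S x * (normal_density 0 (sqrt s) x *
      (\<integral>y. normal_density 0 (sqrt (t - s)) y * G (x + y) \<partial>lborel))" for S x
    by (simp add: H_def mult.assoc mult.left_commute)
  show ?I
    using lborel_pair.integrable_fst'[OF key(1)[of UNIV]] unfolding inner by simp
  show ?E
    using lborel_pair.integral_fst'[OF key(1)[of S]] key(2)[of S] unfolding inner by simp
qed

end

text \<open>The martingale identity is tested on the events that \<open>B 1\<close> lies in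
  \<open>S\<close>. Time 1 rather than 0 is used because the law of \<open>B 1\<close> has a
  strictly positive density, so identities under that law hold Lebesgue almost everywhere.\<close>

lemma (in brownian_motion) gauss_moment_eigenfunction:
  assumes exp_growth: "exponential_growth g C \<kappa>"
    and pos: "\<And>x. 0 < g x"
    and mart: "martingale M (natural_filtration M B)
      (\<lambda>t \<omega>. g (B t \<omega>) / expectation (\<lambda>\<omega>'. g (B t \<omega>')))"
    and b: "0 < b"
  shows "\<exists>q>0. AE x in lborel. gauss_moment g 0 b x = q * g x"
proof -
  interpret exponential_growth g C \<kappa> by fact
  define r where "r = 1 / (2 * b)"
  have r: "0 < r" "b = 1 / (2 * r)" using b by (auto simp: r_def)
  define f where "f t = expectation (\<lambda>\<omega>. g (B t \<omega>))" for t
  define P where "P x = (\<integral>y. normal_density 0 (sqrt r) y * g (x + y) \<partial>lborel)" for x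
  have [measurable]: "random_variable borel (B t)" if "0 \<le> t" for t
    using measurable_B that by auto
  have normal_int: "integrable lborel (\<lambda>x. normal_density 0 (sqrt t) x * g x)" if "0 < t" for t
  proof -
    have "integrable lborel (\<lambda>x. g x * (x - 0) ^ 0 * exp (- (1 / (2 * t)) * (x - 0)\<^sup>2) / sqrt (2 * pi * t))"
      using that by (intro integrable_divide integrable_gauss_moment) auto
    also have "(\<lambda>x. g x * (x - 0) ^ 0 * exp (- (1 / (2 * t)) * (x - 0)\<^sup>2) / sqrt (2 * pi * t)) =
        (\<lambda>x. normal_density 0 (sqrt t) x * g x)"
      using that by (auto simp: normal_density_def fun_eq_iff)
    finally show ?thesis .
  qed
  have int: "integrable M (\<lambda>\<omega>. g (B t \<omega>))" if "0 < t" for t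
    using distributed_integrable[OF distributed_B[OF that], of g] normal_int[OF that] by simp
  have f: "0 < f t" if "0 < t" for t
    unfolding f_def using int[OF that] pos by (intro expectation_greater) auto
  \<comment> \<open>Integrals over all Borel sets \<open>S\<close> determine the integrand almost
    everywhere; the conditional expectation is removed by integrating over an event of the
    past.\<close>
  have eq: "(\<integral>x\<in>S. normal_density 0 1 x * P x / f (1 + r) \<partial>lborel) =
      (\<integral>x\<in>S. normal_density 0 1 x * g x / f 1 \<partial>lborel)" if S: "S \<in> sets lborel" for S
  proof -
    have [measurable]: "S \<in> sets borel" using S by simp
    let ?F = "natural_filtration M B 1"
    let ?A = "B 1 -` S \<inter> space M"
    have "subalgebra M ?F" using mart unfolding martingale_def by simp
    then interpret finite_measure_subalgebra M ?F by unfold_locales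
    have A: "?A \<in> sets ?F"
      unfolding sets_natural_filtration using S by (intro sigma_sets.Basic) force
    have ind: "indicator ?A \<omega> = (indicator S (B 1 \<omega>) :: real)" if "\<omega> \<in> space M" for \<omega>
      using that by (auto simp: indicator_def)
    have ce: "AE \<omega> in M. real_cond_exp M ?F (\<lambda>\<omega>. g (B (1 + r) \<omega>) / f (1 + r)) \<omega> = g (B 1 \<omega>) / f 1"
      using mart r unfolding martingale_def f_def by simp
    have "(\<integral>\<omega>\<in>?A. g (B (1 + r) \<omega>) / f (1 + r) \<partial>M)
        = (\<integral>\<omega>\<in>?A. real_cond_exp M ?F (\<lambda>\<omega>. g (B (1 + r) \<omega>) / f (1 + r)) \<omega> \<partial>M)"
      using int[of "1 + r"] r A by (intro real_cond_exp_intA) auto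
    also have "\<dots> = (\<integral>\<omega>\<in>?A. g (B 1 \<omega>) / f 1 \<partial>M)"
      unfolding set_lebesgue_integral_def using ce by (intro integral_cong_AE) auto
    finally have "(\<integral>\<omega>. indicator S (B 1 \<omega>) * g (B (1 + r) \<omega>) \<partial>M) / f (1 + r)
        = (\<integral>\<omega>. indicator S (B 1 \<omega>) * g (B 1 \<omega>) \<partial>M) / f 1"
      unfolding set_lebesgue_integral_def
      by (simp add: ind cong: Bochner_Integration.integral_cong)
    moreover have "(\<integral>\<omega>. indicator S (B 1 \<omega>) * g (B (1 + r) \<omega>) \<partial>M) =
        (\<integral>x. indicator S x * (normal_density 0 1 x * P x) \<partial>lborel)"
      using integral_transition[of g S "1 + r" 1] int[of "1 + r"] r by (simp add: P_def)
    moreover have "(\<integral>\<omega>. indicator S (B 1 \<omega>) * g (B 1 \<omega>) \<partial>M) =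
        (\<integral>x. normal_density 0 1 x * (indicator S x * g x) \<partial>lborel)"
      using distributed_integral[OF distributed_B[of 1], of "\<lambda>x. indicator S x * g x"] by simp
    ultimately show ?thesis
      by (simp add: set_lebesgue_integral_def mult.left_commute)
  qed
  have "AE x in lborel. normal_density 0 1 x * P x / f (1 + r) = normal_density 0 1 x * g x / f 1"
  proof (rule density_unique_real[OF _ _ eq])
    show "integrable lborel (\<lambda>x. normal_density 0 1 x * P x / f (1 + r))"
      using integrable_transition[of g UNIV "1 + r" 1] int[of "1 + r"] r by (simp add: P_def)
    show "integrable lborel (\<lambda>x. normal_density 0 1 x * g x / f 1)"
      using normal_int[of 1] by simp
  qed
  then have "AE x in lborel. gauss_moment g 0 b x = sqrt (2 * pi * r) * f (1 + r) / f 1 * g x"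
  proof eventually_elim
    fix x assume "normal_density 0 1 x * P x / f (1 + r) = normal_density 0 1 x * g x / f 1"
    \<comment> \<open>The density of \<open>B 1\<close> is never zero and cancels.\<close>
    then have "normal_density 0 1 x * (P x / f (1 + r)) = normal_density 0 1 x * (g x / f 1)"
      by (simp only: times_divide_eq_right)
    then have "P x / f (1 + r) = g x / f 1"
      unfolding mult_cancel_left using normal_density_pos[of 1 0 x] by linarith
    moreover have "gauss_moment g 0 b x = sqrt (2 * pi * r) * P x"
      unfolding P_def gauss_moment_0_eq_normal[OF r(1)] using r by simp
    ultimately show "gauss_moment g 0 b x = sqrt (2 * pi * r) * f (1 + r) / f 1 * g x"
      using f[of 1] f[of "1 + r"] r(1) by (simp add: field_simps)
  qed
  moreover have "0 < sqrt (2 * pi * r) * f (1 + r) / f 1"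
    using f[of 1] f[of "1 + r"] r(1) by simp
  ultimately show ?thesis by blast
qed

section \<open>From the Gaussian averages to the differential equation\<close>

lemma (in exponential_growth) gauss_moment_eigenfunction_ode:
  assumes pos: "\<And>x. 0 < g x"
    and eigen: "\<And>b. 0 < b \<Longrightarrow> \<exists>q>0. AE x in lborel. gauss_moment g 0 b x = q * g x"
  obtains h h' k where "AE x in lborel. g x = h x" "\<And>x. 0 < h x"
    "\<And>x. (h has_real_derivative h' x) (at x)" "\<And>x. (h' has_real_derivative k * h x) (at x)"
proof -
  let ?K = "gauss_moment g"
  obtain q where q: "\<And>b. 0 < b \<Longrightarrow> 0 < q b"
    "\<And>b. 0 < b \<Longrightarrow> AE x in lborel. ?K 0 b x = q b * g x"
    using eigen by metis
  \<comment> \<open>The exponent \<open>1 / 2\<close> is variance one; there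
    \<open>2 * b = 1\<close>, so the rule for differentiating in the center carries no extra
    factor.\<close>
  define h where "h x = ?K 0 (1 / 2) x / q (1 / 2)" for x
  have g_eq_h: "AE x in lborel. g x = h x"
    using q(2)[of "1 / 2", simplified] by eventually_elim (use q(1)[of "1 / 2"] in \<open>simp add: h_def\<close>)
  have h_pos: "0 < h x" for x
    using gauss_moment_0_pos[OF pos] q(1)[of "1 / 2"] by (simp add: h_def)
  have cont: "continuous_on UNIV (?K 0 b)" if "0 < b" for b
    using has_derivative_gauss_moment_center[OF that, of 0]
    by (intro DERIV_continuous_on) (auto intro: has_field_derivative_at_within)
  \<comment> \<open>The exceptional null set in \<open>q(2)\<close> may depend on \<open>b\<close>.
    Continuity removes it, so that \<open>x\<close> can be fixed while \<open>b\<close>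
    varies.\<close>
  have K_h: "?K 0 b x = q b * h x" if b: "0 < b" for b x
  proof (rule continuous_AE_eq_imp_eq[OF cont[OF b]])
    show "continuous_on UNIV (\<lambda>x. q b * h x)"
      unfolding h_def using q(1)[of "1 / 2"] by (intro continuous_intros cont) auto
    show "AE x in lborel. ?K 0 b x = q b * h x"
      using q(2)[OF b] g_eq_h by eventually_elim simp
  qed
  \<comment> \<open>Since \<open>q (1 / 2) * h 0\<close> is \<open>?K 0 (1 / 2) 0\<close>, this is
    the ratio of the second to the zeroth moment at the point 0.\<close>
  define \<mu> where "\<mu> = ?K 2 (1 / 2) 0 / h 0 * inverse (q (1 / 2))"
  \<comment> \<open>The factor \<open>q b\<close> does not depend on the point, so \<open>?K 0 b x\<close> and \<open>?K 0 b 0\<close> are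
    proportional as functions of \<open>b\<close>, and so are their derivatives.\<close>
  have K2: "?K 2 (1 / 2) x = \<mu> * ?K 0 (1 / 2) x" for x
  proof -
    have D: "((\<lambda>b. ?K 0 b z) has_real_derivative - ?K 2 (1 / 2) z) (at (1 / 2))" for z
      using has_derivative_gauss_moment_exponent[of "1 / 2" 0 z] by (simp add: numeral_2_eq_2)
    have "((\<lambda>b. ?K 0 b 0 * (h x / h 0)) has_real_derivative - ?K 2 (1 / 2) 0 * (h x / h 0)) (at (1 / 2))"
      by (rule DERIV_cmult_right[OF D])
    then have "((\<lambda>b. ?K 0 b x) has_real_derivative - ?K 2 (1 / 2) 0 * (h x / h 0)) (at (1 / 2))"
    proof (rule has_field_derivative_transform_within_open[of _ _ _ "{0<..}"])
      fix b :: real assume "b \<in> {0<..}"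
      then show "?K 0 b 0 * (h x / h 0) = ?K 0 b x" using h_pos[of 0] K_h[of b] by simp
    qed auto
    then have "?K 2 (1 / 2) x = ?K 2 (1 / 2) 0 * (h x / h 0)"
      using DERIV_unique[OF D] by fastforce
    then show ?thesis using q(1)[of "1 / 2"] K_h[of "1 / 2" x] by (simp add: \<mu>_def)
  qed
  have h': "(h has_real_derivative ?K 1 (1 / 2) x / q (1 / 2)) (at x)" for x
    unfolding h_def
    using DERIV_cdivide[OF has_derivative_gauss_moment_center[of "1 / 2" 0 x]] by simp
  \<comment> \<open>Differentiating the zeroth moment twice in the center gives the second moment
    minus the zeroth, hence the eigenvalue \<open>\<mu> - 1\<close>.\<close>
  have h'': "((\<lambda>x. ?K 1 (1 / 2) x / q (1 / 2)) has_real_derivative (\<mu> - 1) * h x) (at x)" for x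
  proof -
    have "((\<lambda>x. ?K 1 (1 / 2) x / q (1 / 2)) has_real_derivative
        (?K 2 (1 / 2) x - ?K 0 (1 / 2) x) / q (1 / 2)) (at x)"
      using DERIV_cdivide[OF has_derivative_gauss_moment_center[of "1 / 2" 1 x]]
      by (simp add: numeral_2_eq_2)
    then show ?thesis by (simp add: K2 h_def algebra_simps)
  qed
  show thesis using that[OF g_eq_h h_pos h' h''] .
qed

theorem theorem3p3:
  fixes M :: "'w measure" and B :: "real \<Rightarrow> 'w \<Rightarrow> real" and g :: "real \<Rightarrow> real"
  assumes "brownian_motion M B"
    and "g \<in> borel_measurable borel"
    and "\<And>x. 0 < g x"
    and "grows_at_most_exponentially g"
    and "martingale M (natural_filtration M B)
           (\<lambda>t \<omega>. g (B t \<omega>) / prob_space.expectation M (\<lambda>\<omega>'. g (B t \<omega>')))"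
  shows "(\<exists>h :: real \<Rightarrow> real. twice_differentiable h \<and> (AE x in lborel. g x = h x) \<and>
            (\<forall>x. h x \<noteq> 0) \<and> (\<lambda>x. bm_generator h x / h x) constant_on UNIV) \<and>
         (\<exists>a b c :: real. 0 \<le> a \<and> 0 \<le> b \<and> 0 \<le> c \<and>
            (AE x in lborel. g x = a * exp (c * x) + b * exp (- c * x)))"
proof -
  interpret brownian_motion M B by fact
  obtain C \<kappa> where growth: "\<And>x. \<bar>g x\<bar> \<le> C * exp (\<kappa> * \<bar>x\<bar>)"
    using assms(4) unfolding grows_at_most_exponentially_def by blast
  interpret exponential_growth g C \<kappa>
    using assms(2) growth by unfold_locales
  obtain h h' k where g_eq_h: "AE x in lborel. g x = h x" and h_pos: "\<And>x. 0 < h x"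
    and h': "\<And>x. (h has_real_derivative h' x) (at x)"
    and h'': "\<And>x. (h' has_real_derivative k * h x) (at x)"
    using gauss_moment_eigenfunction_ode[OF assms(3)
        gauss_moment_eigenfunction[OF exponential_growth_axioms assms(3,5)]] by blast
  have deriv_h: "deriv h = h'" "deriv h' = (\<lambda>x. k * h x)"
    using h' h'' by (auto intro!: DERIV_imp_deriv)
  have "twice_differentiable h"
    unfolding twice_differentiable_def deriv_h(1)
    using h' h'' by (auto simp: field_differentiable_def)
  moreover have "(\<lambda>x. bm_generator h x / h x) constant_on UNIV"
    unfolding constant_on_def bm_generator_def deriv_h
    \<comment> \<open>The generator is half the second derivative, so the constant is half of
      \<open>k\<close>.\<close>
    by (rule exI[of _ "k / 2"]) (use h_pos in \<open>simp add: less_imp_neq[THEN not_sym]\<close>)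
  moreover obtain a b c where "0 \<le> a" "0 \<le> b" "0 \<le> c"
    and h_eq: "\<And>x. h x = a * exp (c * x) + b * exp (- c * x)"
    using positive_solution_form[OF h' h'' h_pos] by blast
  moreover have "AE x in lborel. g x = a * exp (c * x) + b * exp (- c * x)"
    using g_eq_h unfolding h_eq .
  moreover have "\<forall>x. h x \<noteq> 0"
    using h_pos less_irrefl by metis
  ultimately show ?thesis
    using g_eq_h by blast
qed

end
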